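(* Let $v\ge 3$, let $\mathbf s=(s_1,\dots,s_v)$ be an arbitrary vector of non-negative integers, and let $m\le \Sigma(\mathbf s)$. Then the greedy strategy is the unique optimal strategy for the $m$-round $\mathbf s$-game.
   Context: For a vector $\mathbf s=(s_1,\dots,s_v)$ of non-negative integers, the $\mathbf s$-deck consists of $s_i$ cards of Value $i$ for each $i\in\{1,\dots,v\}$; $\Sigma(\mathbf s)=s_1+\dots+s_v$. In the $m$-round $\mathbf s$-game, the deck is shuffled uniformly at random; in each of $m$ rounds the player names a value in $\{1,\dots,v\}$ and then the top card of the remaining deck is turned face up. The player loses if in at least one round the turned card has the named value, and wins otherwise. Strategies are adaptive: the bid in each round may depend on the cards turned in previous rounds. The greedy strategy is any strategy which in every round names a value that appears the least number of times among the cards remaining in the deck (any two such strategies have the same winning probability, and are collectively called the greedy strategy). A strategy is optimal if it maximizes the probability of winning. *)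

theory Defs
  imports "HOL-Probability.Probability"
begin

text \<open>
  A card is a pair \<open>(i, j)\<close>, where \<open>i\<close> is its value and \<open>j\<close> merely tells apart the
  cards of value \<open>i\<close>.
\<close>

definition cards :: "nat \<Rightarrow> (nat \<Rightarrow> nat) \<Rightarrow> (nat \<times> nat) set" where
  "cards v s = (SIGMA i:{1..v}. {1..s i})"

definition shuffled_deck :: "nat \<Rightarrow> (nat \<Rightarrow> nat) \<Rightarrow> nat list pmf" where
  "shuffled_deck v s = map_pmf (map fst) (pmf_of_set (permutations_of_set (cards v s)))"

text \<open>
  A strategy maps the list of the values turned so far, in chronological order, to the next bid.
\<close>

definition strategy :: "nat \<Rightarrow> (nat list \<Rightarrow> nat) \<Rightarrow> bool" where
  "strategy v \<sigma> \<longleftrightarrow> (\<forall>h. \<sigma> h \<in> {1..v})"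

text \<open>
  In round \<open>k + 1\<close> the card \<open>xs ! k\<close> is turned, after the cards \<open>take k xs\<close> have been seen.
\<close>

definition survives :: "nat \<Rightarrow> (nat list \<Rightarrow> nat) \<Rightarrow> nat list \<Rightarrow> bool" where
  "survives m \<sigma> xs \<longleftrightarrow> (\<forall>k<m. xs ! k \<noteq> \<sigma> (take k xs))"

definition win_prob :: "nat \<Rightarrow> (nat \<Rightarrow> nat) \<Rightarrow> nat \<Rightarrow> (nat list \<Rightarrow> nat) \<Rightarrow> real" where
  "win_prob v s m \<sigma> = measure_pmf.prob (shuffled_deck v s) {xs. survives m \<sigma> xs}"

definition optimal :: "nat \<Rightarrow> (nat \<Rightarrow> nat) \<Rightarrow> nat \<Rightarrow> (nat list \<Rightarrow> nat) \<Rightarrow> bool" where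
  "optimal v s m \<sigma> \<longleftrightarrow>
     strategy v \<sigma> \<and> (\<forall>\<tau>. strategy v \<tau> \<longrightarrow> win_prob v s m \<tau> \<le> win_prob v s m \<sigma>)"

definition greedy :: "nat \<Rightarrow> (nat \<Rightarrow> nat) \<Rightarrow> nat \<Rightarrow> (nat list \<Rightarrow> nat) \<Rightarrow> bool" where
  "greedy v s m \<sigma> \<longleftrightarrow>
     strategy v \<sigma> \<and>
     (\<forall>xs\<in>set_pmf (shuffled_deck v s). \<forall>k<m. \<forall>j\<in>{1..v}.
        count_list (drop k xs) (\<sigma> (take k xs)) \<le> count_list (drop k xs) j)"

text \<open>
  A strategy, as a function, also prescribes bids for rounds after the player has already lost;
  these have no influence on the outcome. So two strategies are the same for the game if they make
  the same bid in every round that can be reached without having lost.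
\<close>

definition same_play ::
    "nat \<Rightarrow> (nat \<Rightarrow> nat) \<Rightarrow> nat \<Rightarrow> (nat list \<Rightarrow> nat) \<Rightarrow> (nat list \<Rightarrow> nat) \<Rightarrow> bool" where
  "same_play v s m \<sigma> \<tau> \<longleftrightarrow>
     (\<forall>xs\<in>set_pmf (shuffled_deck v s). \<forall>k<m.
        survives k \<sigma> xs \<longrightarrow> \<sigma> (take k xs) = \<tau> (take k xs))"

lemma finite_cards: "finite (cards v s)"
  unfolding cards_def by auto

lemma set_shuffled_deck:
  "set_pmf (shuffled_deck v s) = map fst ` permutations_of_set (cards v s)"
  unfolding shuffled_deck_def by (simp add: finite_cards)

lemma count_list_shuffled_deck:
  assumes "xs \<in> set_pmf (shuffled_deck v s)" "j \<in> {1..v}"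
  shows "count_list xs j = s j"
proof -
  obtain cs where cs: "set cs = cards v s" "distinct cs" "xs = map fst cs"
    using assms(1) by (auto simp: set_shuffled_deck permutations_of_set_def)
  have "count_list xs j = length (filter (\<lambda>c. fst c = j) cs)"
    unfolding cs(3) by (induction cs) auto
  also have "\<dots> = card (set (filter (\<lambda>c. fst c = j) cs))"
    using cs(2) by (metis distinct_card distinct_filter)
  also have "set (filter (\<lambda>c. fst c = j) cs) = {j} \<times> {1..s j}"
    using cs(1) assms(2) by (auto simp: cards_def)
  finally show ?thesis by (simp add: card_cartesian_product)
qed

lemma greedy_exists:
  assumes "v \<ge> 1"
  shows "\<exists>\<sigma>. greedy v s m \<sigma>"
proof -
  have "\<exists>i\<in>{1..v}. \<forall>j\<in>{1..v}. s i - count_list h i \<le> s j - count_list h j" for h :: "nat list"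
    using assms ex_min_if_finite[of "(\<lambda>i. s i - count_list h i) ` {1..v}"] by (force simp: not_less)
  then obtain \<sigma> where \<sigma>: "\<And>h. \<sigma> h \<in> {1..v}"
    "\<And>h j. j \<in> {1..v} \<Longrightarrow> s (\<sigma> h) - count_list h (\<sigma> h) \<le> s j - count_list h j"
    by metis
  have "count_list (drop k xs) j = s j - count_list (take k xs) j"
    if "xs \<in> set_pmf (shuffled_deck v s)" "j \<in> {1..v}" for xs k j
    using count_list_append[of "take k xs" "drop k xs" j] count_list_shuffled_deck[OF that] by simp
  with \<sigma> have "greedy v s m \<sigma>"
    unfolding greedy_def strategy_def by simp
  then show ?thesis by blast
qed

end

theory Submission
  imports Defs
begin

text \<open>
  Let \<open>f m s\<close> be the best winning probability with \<open>m\<close> rounds left and deck \<open>s\<close>, scaled by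
  \<open>\<Sigma>(s) (\<Sigma>(s) - 1) \<dots> (\<Sigma>(s) - m + 1)\<close>. Then
  \<open>f (m + 1) s = max\<^sub>i \<Sum>\<^sub>k\<^sub>\<noteq>\<^sub>i s\<^sub>k f m (s - e\<^sub>k)\<close>, so bidding a rarest value is the unique optimal move as
  soon as \<open>s\<^sub>i < s\<^sub>j\<close> implies \<open>s\<^sub>i f m (s - e\<^sub>i) < s\<^sub>j f m (s - e\<^sub>j)\<close>. This is proved by induction on
  \<open>m\<close>: by the induction hypothesis both sides expand along a common greedy bid \<open>c\<close>, and the
  resulting sums are compared term by term. The bid \<open>c\<close> is a value other than \<open>i\<close>, \<open>j\<close> if one of these
  has fewer than \<open>s\<^sub>i\<close> cards, and \<open>i\<close> otherwise; in the latter case strictness comes from a third value.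
\<close>

section \<open>Values of optimal play and their symmetry\<close>

primrec best :: "nat \<Rightarrow> nat \<Rightarrow> (nat \<Rightarrow> nat) \<Rightarrow> nat" where
  "best v 0 s = 1"
| "best v (Suc m) s =
     Max ((\<lambda>i. \<Sum>k\<in>{1..v} - {i}. s k * best v m (s(k := s k - 1))) ` {1..v})"

text \<open>What a bid on \<open>k\<close> forfeits: it yields the sum of all weights minus this
  one, so a bid is best iff its weight is least. If \<open>s k = 0\<close>, the factor
  \<open>s k\<close> makes the truncated \<open>s k - 1\<close> harmless.\<close>

definition weight :: "nat \<Rightarrow> nat \<Rightarrow> (nat \<Rightarrow> nat) \<Rightarrow> nat \<Rightarrow> nat" where
  "weight v m s k = s k * best v m (s(k := s k - 1))"

lemma best_Suc:
  "best v (Suc m) s = Max ((\<lambda>i. \<Sum>k\<in>{1..v} - {i}. weight v m s k) ` {1..v})"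
  by (simp add: weight_def)

declare best.simps(2) [simp del]

lemma best_ge_bid:
  "i \<in> {1..v} \<Longrightarrow> (\<Sum>k\<in>{1..v} - {i}. weight v m s k) \<le> best v (Suc m) s"
  unfolding best_Suc by (intro Max_ge) auto

text \<open>Relabelling values commutes with removing a card and with maximizing over bids. This
  serves ties: through \<open>weight_cong\<close>, values with equally many cards get equal
  weight.\<close>

lemma best_permute: "\<pi> permutes {1..v} \<Longrightarrow> best v m (s \<circ> \<pi>) = best v m s"
proof (induction m arbitrary: s)
  case (Suc m)
  note \<pi> = Suc.prems
  have *: "(s \<circ> \<pi>)(k := (s \<circ> \<pi>) k - 1) = s(\<pi> k := s (\<pi> k) - 1) \<circ> \<pi>" for k
    using permutes_inj[OF \<pi>] by (auto simp: fun_eq_iff inj_eq)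
  have w: "weight v m (s \<circ> \<pi>) k = weight v m s (\<pi> k)" for k
    unfolding weight_def * Suc.IH[OF \<pi>] by simp
  have "(\<Sum>k\<in>{1..v} - {i}. weight v m (s \<circ> \<pi>) k) = (\<Sum>k\<in>{1..v} - {\<pi> i}. weight v m s k)" for i
  proof -
    have "bij_betw \<pi> ({1..v} - {i}) ({1..v} - {\<pi> i})"
      using permutes_inj[OF \<pi>] permutes_image[OF \<pi>]
      by (auto simp: bij_betw_def inj_on_def inj_def image_set_diff)
    then show ?thesis
      unfolding w by (rule sum.reindex_bij_betw)
  qed
  then have "(\<lambda>i. \<Sum>k\<in>{1..v} - {i}. weight v m (s \<circ> \<pi>) k) ` {1..v} =
      (\<lambda>i. \<Sum>k\<in>{1..v} - {i}. weight v m s k) ` \<pi> ` {1..v}"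
    by (simp add: image_image)
  then show ?case
    unfolding best_Suc permutes_image[OF \<pi>] by simp
qed simp

lemma weight_cong:
  assumes "i \<in> {1..v}" "j \<in> {1..v}" "s i = s j"
  shows "weight v m s i = weight v m s j"
proof -
  have "s(i := s i - 1) \<circ> Transposition.transpose i j = s(j := s j - 1)"
  proof
    fix x
    show "(s(i := s i - 1) \<circ> Transposition.transpose i j) x = (s(j := s j - 1)) x"
      using assms(3) by (cases "x = i"; cases "x = j") auto
  qed
  then have "best v m (s(i := s i - 1)) = best v m (s(j := s j - 1))"
    using best_permute[OF permutes_swap_id[OF assms(1,2)], of m "s(i := s i - 1)"] by metis
  then show ?thesis
    unfolding weight_def assms(3) by (rule arg_cong)
qed

lemma sum_remove_card:
  fixes s :: "nat \<Rightarrow> nat"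
  assumes "k \<in> {1..v}" "0 < s k"
  shows "(\<Sum>i=1..v. (s(k := s k - 1)) i) = (\<Sum>i=1..v. s i) - 1"
proof -
  have "(\<Sum>i\<in>{1..v} - {k}. (s(k := s k - 1)) i) = (\<Sum>i\<in>{1..v} - {k}. s i)"
    by (intro sum.cong) auto
  then show ?thesis
    using assms(2) sum.remove[OF finite_atLeastAtMost assms(1), of s]
      sum.remove[OF finite_atLeastAtMost assms(1), of "s(k := s k - 1)"]
    by simp
qed

text \<open>A bid on the absent value \<open>i\<close> cannot lose, and \<open>i\<close> stays
  absent as other cards are turned.\<close>

lemma best_pos:
  assumes "i \<in> {1..v}" "s i = 0" "m \<le> (\<Sum>k=1..v. s k)"
  shows "0 < best v m s"
  using assms
proof (induction m arbitrary: s)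
  case (Suc m)
  then obtain k where k: "k \<in> {1..v}" "0 < s k"
    by (metis gr0I not_less_eq_eq sum.neutral zero_le)
  with Suc.prems have "k \<noteq> i" by auto
  have "0 < best v m (s(k := s k - 1))"
    using Suc.prems k \<open>k \<noteq> i\<close> sum_remove_card[of k v s] by (intro Suc.IH) auto
  then have "0 < weight v m s k"
    using k by (simp add: weight_def)
  also have "\<dots> \<le> (\<Sum>k\<in>{1..v} - {i}. weight v m s k)"
    using k \<open>k \<noteq> i\<close> by (intro member_le_sum) auto
  also have "\<dots> \<le> best v (Suc m) s"
    using Suc.prems(1) by (rule best_ge_bid)
  finally show ?case .
qed simp

lemma best_Suc_eqI:
  assumes "c \<in> {1..v}" and min: "\<And>k. k \<in> {1..v} \<Longrightarrow> weight v m s c \<le> weight v m s k"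
  shows "best v (Suc m) s = (\<Sum>k\<in>{1..v} - {c}. weight v m s k)"
  unfolding best_Suc
proof (intro Max_eqI)
  fix y assume "y \<in> (\<lambda>i. \<Sum>k\<in>{1..v} - {i}. weight v m s k) ` {1..v}"
  then obtain i where i: "i \<in> {1..v}" "y = (\<Sum>k\<in>{1..v} - {i}. weight v m s k)" by auto
  then show "y \<le> (\<Sum>k\<in>{1..v} - {c}. weight v m s k)"
    using min[of i] assms(1) sum.remove[of "{1..v}" i "weight v m s"]
      sum.remove[of "{1..v}" c "weight v m s"] by simp
qed (use assms in auto)

section \<open>Strict monotonicity of the weights\<close>

text \<open>With only two values strictness can fail: for counts 1 and 2 and \<open>m = 1\<close>
  both weights are 2. The bound on \<open>m\<close> leaves enough cards for \<open>m\<close> rounds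
  after one card is removed.\<close>

lemma weight_strict_mono:
  assumes "3 \<le> v" "m < (\<Sum>k=1..v. s k)" "i \<in> {1..v}" "j \<in> {1..v}" "s i < s j"
  shows "weight v m s i < weight v m s j"
  using assms
proof (induction m arbitrary: s i j)
  case 0
  then show ?case by (simp add: weight_def)
next
  case (Suc m)
  note ij = Suc.prems(3,4) and less = Suc.prems(5)
  let ?V = "{1..v}"
  \<comment> \<open>The induction hypothesis covers unequal counts, symmetry covers ties. This weak
    form is what \<open>best_Suc_eqI\<close> asks of a bid.\<close>
  have le: "weight v m r x \<le> weight v m r y"
    if "m < (\<Sum>k=1..v. r k)" "x \<in> ?V" "y \<in> ?V" "r x \<le> r y" for r x y
    using that Suc.IH[OF \<open>3 \<le> v\<close>, of r x y] weight_cong[of x v y r m] by (cases "r x = r y") auto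
  show ?case
  proof (cases "s i = 0")
    case True
    \<comment> \<open>The value \<open>i\<close> is still absent from this deck, so its best value
      is positive, whereas the weight of \<open>i\<close> is 0.\<close>
    have "0 < best v (Suc m) (s(j := s j - 1))"
      using Suc.prems True sum_remove_card[of j v s] by (intro best_pos[of i]) auto
    then show ?thesis using less True by (simp add: weight_def)
  next
    case False
    \<comment> \<open>The claim is now
      \<open>s i * best v (Suc m) P < s j * best v (Suc m) Q\<close>. Both values are expanded over
      the next card \<open>k\<close>, and the terms for each \<open>k\<close> are compared.\<close>
    define P where "P = s(i := s i - 1)"
    define Q where "Q = s(j := s j - 1)"
    have "i \<noteq> j" using less by auto
    have sums: "m < sum P ?V" "m < sum Q ?V"
      using Suc.prems sum_remove_card[of i v s] sum_remove_card[of j v s] False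
      by (auto simp: P_def Q_def)
    have P_Q: "P i = s i - 1" "P j = s j" "Q i = s i" "Q j = s j - 1"
      "\<And>k. k \<noteq> i \<Longrightarrow> k \<noteq> j \<Longrightarrow> P k = s k \<and> Q k = s k"
      using \<open>i \<noteq> j\<close> by (auto simp: P_def Q_def)
    \<comment> \<open>Removals commute: both terms carry the factor \<open>s k\<close>, and what
      remains is the induction hypothesis for the deck \<open>r\<close> that lacks one card of value
      \<open>k\<close>.\<close>
    have other_strict: "s i * weight v m P k < s j * weight v m Q k"
      if "k \<in> ?V" "k \<noteq> i" "k \<noteq> j" "0 < s k" for k
    proof -
      define r where "r = s(k := s k - 1)"
      have "m < sum r ?V"
        using Suc.prems(2) sum_remove_card[of k v s] that by (auto simp: r_def)
      then have "weight v m r i < weight v m r j"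
        using that ij less by (intro Suc.IH[OF \<open>3 \<le> v\<close>]) (auto simp: r_def)
      then have "s i * best v m (r(i := s i - 1)) < s j * best v m (r(j := s j - 1))"
        using that by (simp add: weight_def r_def)
      moreover have "r(i := s i - 1) = P(k := P k - 1)" "r(j := s j - 1) = Q(k := Q k - 1)"
        using that by (auto simp: r_def P_def Q_def fun_eq_iff)
      ultimately show ?thesis
        using that P_Q(5)[of k] mult_strict_left_mono[of _ _ "s k"]
        by (simp add: weight_def mult.left_commute del: mult_less_cancel1)
    qed
    then have other: "s i * weight v m P k \<le> s j * weight v m Q k"
      if "k \<in> ?V" "k \<noteq> i" "k \<noteq> j" for k
    proof (cases "s k = 0")
      case True
      then show ?thesis using that P_Q(5)[of k] by (simp add: weight_def)
    qed (use that in \<open>auto intro: less_imp_le\<close>)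
    \<comment> \<open>Removing cards of values \<open>i\<close> and \<open>j\<close> in either order
      leaves the same deck, so the mixed terms \<open>s i * weight v m P j\<close> and
      \<open>s j * weight v m Q i\<close> are both \<open>s i * s j * X\<close>. They serve as the
      middle link in the comparisons for \<open>i\<close> and \<open>j\<close>.\<close>
    define X where "X = best v m (s(i := s i - 1, j := s j - 1))"
    have X: "weight v m P j = s j * X" "weight v m Q i = s i * X"
      using \<open>i \<noteq> j\<close> by (auto simp: X_def P_def Q_def weight_def fun_upd_twist)
    have "weight v m P i < weight v m P j"
      using ij less sums by (intro Suc.IH[OF \<open>3 \<le> v\<close>]) (auto simp: P_Q)
    then have i_less: "s i * weight v m P i < s j * weight v m Q i"
      using False X by (simp add: mult.left_commute)
    \<comment> \<open>Only weak, since \<open>Q i = Q j\<close> when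
      \<open>s j = s i + 1\<close>.\<close>
    have "weight v m Q i \<le> weight v m Q j"
      using ij less sums by (intro le) (auto simp: P_Q)
    then have j_le: "s i * weight v m P j \<le> s j * weight v m Q j"
      using X by (simp add: mult.left_commute)
    \<comment> \<open>A value rarest in both decks is an optimal bid in both, so the two expansions
      omit the same index.\<close>
    have expand: "s i * (\<Sum>k\<in>?V - {c}. weight v m P k) < s j * (\<Sum>k\<in>?V - {c}. weight v m Q k)
        \<Longrightarrow> weight v (Suc m) s i < weight v (Suc m) s j"
      if c: "c \<in> ?V" "\<And>k. k \<in> ?V \<Longrightarrow> P c \<le> P k \<and> Q c \<le> Q k" for c
    proof -
      have "best v (Suc m) P = (\<Sum>k\<in>?V - {c}. weight v m P k)"
        "best v (Suc m) Q = (\<Sum>k\<in>?V - {c}. weight v m Q k)"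
        using c sums by (blast intro!: best_Suc_eqI le)+
      then show ?thesis
        if "s i * (\<Sum>k\<in>?V - {c}. weight v m P k) < s j * (\<Sum>k\<in>?V - {c}. weight v m Q k)"
        using that by (simp add: weight_def[of v "Suc m"] P_def Q_def)
    qed
    \<comment> \<open>\<open>3 \<le> v\<close> provides a value besides \<open>i\<close> and
      \<open>j\<close>; \<open>c\<close> will be a rarest such value.\<close>
    have "card {i, j} < card ?V"
      using \<open>3 \<le> v\<close> \<open>i \<noteq> j\<close> by simp
    then have "\<not> ?V \<subseteq> {i, j}"
      by (meson card_mono finite.emptyI finite.insertI leD)
    then have "?V - {i, j} \<noteq> {}" by blast
    then obtain c where c: "c \<in> ?V" "c \<noteq> i" "c \<noteq> j"
      and c_min: "\<And>k. k \<in> ?V \<Longrightarrow> k \<noteq> i \<Longrightarrow> k \<noteq> j \<Longrightarrow> s c \<le> s k"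
      using ex_min_if_finite[of "s ` (?V - {i, j})"] by (force simp: not_less)
    show ?thesis
    proof (cases "s c < s i")
      case True
      \<comment> \<open>Since \<open>s c \<le> s i - 1\<close>, the value \<open>c\<close> is rarest
        even in \<open>P\<close>, where one card of value \<open>i\<close> is gone. The term for
        \<open>i\<close> is kept and gives strictness.\<close>
      have "P c \<le> P k \<and> Q c \<le> Q k" if "k \<in> ?V" for k
        using c c_min[of k] that True less P_Q by (cases "k = i"; cases "k = j") auto
      moreover have "s i * (\<Sum>k\<in>?V - {c}. weight v m P k) < s j * (\<Sum>k\<in>?V - {c}. weight v m Q k)"
        unfolding sum_distrib_left
      proof (rule sum_strict_mono_ex1)
        show "\<forall>k\<in>?V - {c}. s i * weight v m P k \<le> s j * weight v m Q k"
          using other i_less j_le by (metis DiffD1 less_imp_le)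
        show "\<exists>k\<in>?V - {c}. s i * weight v m P k < s j * weight v m Q k"
          using i_less ij c by auto
      qed simp
      ultimately show ?thesis using expand[of c] c(1) by blast
    next
      case i_min: False
      \<comment> \<open>Here \<open>i\<close> is rarest in both decks; in \<open>Q\<close> this uses
        \<open>s i \<le> s j - 1\<close>. Bidding \<open>i\<close> drops its strict term, and
        strictness comes from \<open>c\<close>, which is present because
        \<open>s c \<ge> s i > 0\<close>.\<close>
      have "P i \<le> P k \<and> Q i \<le> Q k" if "k \<in> ?V" for k
        using c c_min[of k] that i_min less P_Q by (cases "k = i"; cases "k = j") auto
      moreover have "s i * (\<Sum>k\<in>?V - {i}. weight v m P k) < s j * (\<Sum>k\<in>?V - {i}. weight v m Q k)"
        unfolding sum_distrib_left
      proof (rule sum_strict_mono_ex1)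
        show "\<forall>k\<in>?V - {i}. s i * weight v m P k \<le> s j * weight v m Q k"
          using other j_le by (metis DiffD1 DiffD2 singletonI)
        show "\<exists>k\<in>?V - {i}. s i * weight v m P k < s j * weight v m Q k"
          using other_strict[of c] c i_min False by (intro bexI[of _ c]) auto
      qed simp
      ultimately show ?thesis using expand[of i] ij(1) by blast
    qed
  qed
qed

text \<open>Weights order the values exactly as their counts do: strictly by
  \<open>weight_strict_mono\<close>, with ties by \<open>weight_cong\<close>.\<close>

lemma bid_eq_best_iff:
  assumes "3 \<le> v" "m < (\<Sum>k=1..v. s k)" "i \<in> {1..v}"
  shows "(\<Sum>k\<in>{1..v} - {i}. weight v m s k) = best v (Suc m) s \<longleftrightarrow> (\<forall>j\<in>{1..v}. s i \<le> s j)"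
proof
  assume eq: "(\<Sum>k\<in>{1..v} - {i}. weight v m s k) = best v (Suc m) s"
  show "\<forall>j\<in>{1..v}. s i \<le> s j"
  proof (rule ccontr)
    assume "\<not> ?thesis"
    then obtain j where j: "j \<in> {1..v}" "s j < s i" by (auto simp: not_le)
    then have "weight v m s j < weight v m s i"
      using assms by (intro weight_strict_mono)
    then have "(\<Sum>k\<in>{1..v} - {i}. weight v m s k) < (\<Sum>k\<in>{1..v} - {j}. weight v m s k)"
      using assms j sum.remove[of "{1..v}" i "weight v m s"]
        sum.remove[of "{1..v}" j "weight v m s"] by simp
    then show False using eq best_ge_bid[OF j(1), of m s] by simp
  qed
next
  assume "\<forall>j\<in>{1..v}. s i \<le> s j"
  then have "weight v m s i \<le> weight v m s j" if "j \<in> {1..v}" for j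
    using that assms weight_strict_mono[of v m s i j] weight_cong[of i v j s m]
    by (cases "s i = s j") force+
  then show "(\<Sum>k\<in>{1..v} - {i}. weight v m s k) = best v (Suc m) s"
    using assms(3) by (intro best_Suc_eqI[symmetric]) auto
qed

section \<open>Counting the winning orders of a deck\<close>

definition value_count :: "(nat \<times> nat) set \<Rightarrow> nat \<Rightarrow> nat" where
  "value_count C i = card {c \<in> C. fst c = i}"

text \<open>Cards of equal value are kept distinct, so that all orders are equally likely and the
  deck after turning \<open>x\<close> is just \<open>C - {x}\<close>.\<close>

definition winning_orders :: "(nat \<times> nat) set \<Rightarrow> nat \<Rightarrow> (nat list \<Rightarrow> nat) \<Rightarrow> nat" where
  "winning_orders C m \<sigma> = card {cs \<in> permutations_of_set C. survives m \<sigma> (map fst cs)}"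

text \<open>Grouping cards by value produces the multiplicities that appear in \<open>weight\<close>
  as the factor \<open>s k\<close>.\<close>

lemma sum_by_value:
  fixes g :: "nat \<Rightarrow> nat"
  assumes "finite C" "fst ` C \<subseteq> {1..v}"
  shows "(\<Sum>x\<in>{x\<in>C. fst x \<noteq> i}. g (fst x)) = (\<Sum>k\<in>{1..v} - {i}. value_count C k * g k)"
proof -
  have "(\<Sum>x\<in>{x\<in>C. fst x \<noteq> i}. g (fst x)) =
      (\<Sum>k\<in>{1..v} - {i}. \<Sum>x\<in>{x \<in> {x\<in>C. fst x \<noteq> i}. fst x = k}. g (fst x))"
    using assms by (intro sum.group[symmetric]) auto
  also have "\<dots> = (\<Sum>k\<in>{1..v} - {i}. value_count C k * g k)"
  proof (intro sum.cong refl)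
    fix k assume "k \<in> {1..v} - {i}"
    then have "{x \<in> {x\<in>C. fst x \<noteq> i}. fst x = k} = {x\<in>C. fst x = k}" by auto
    then show "(\<Sum>x\<in>{x \<in> {x\<in>C. fst x \<noteq> i}. fst x = k}. g (fst x)) = value_count C k * g k"
      by (simp add: value_count_def)
  qed
  finally show ?thesis .
qed

lemma sum_value_count:
  assumes "finite C" "fst ` C \<subseteq> {1..v}"
  shows "(\<Sum>k=1..v. value_count C k) = card C"
proof -
  \<comment> \<open>\<open>0\<close> is not a value, so excluding it excludes no card.\<close>
  have "{x\<in>C. fst x \<noteq> 0} = C" "{1..v} - {0} = {1..v}" using assms(2) by auto
  then show ?thesis using sum_by_value[OF assms, of "\<lambda>_. 1" 0] by simp
qed

lemma value_count_remove:
  assumes "finite C" "x \<in> C"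
  shows "value_count (C - {x}) = (value_count C)(fst x := value_count C (fst x) - 1)"
proof
  fix i
  have "{c \<in> C - {x}. fst c = i} = (if i = fst x then {c\<in>C. fst c = i} - {x} else {c\<in>C. fst c = i})"
    by auto
  then show "value_count (C - {x}) i = ((value_count C)(fst x := value_count C (fst x) - 1)) i"
    using assms by (simp add: value_count_def)
qed

lemma survives_Cons:
  "survives (Suc m) \<sigma> (x # xs) \<longleftrightarrow> x \<noteq> \<sigma> [] \<and> survives m (\<lambda>h. \<sigma> (x # h)) xs"
  unfolding survives_def by (simp add: All_less_Suc2)

lemma Cons_in_permutations:
  "x # cs \<in> permutations_of_set C \<longleftrightarrow> x \<in> C \<and> cs \<in> permutations_of_set (C - {x})"
  by (auto simp: permutations_of_set_def)

text \<open>Split by the first card \<open>x\<close>, whose value must differ from the bid; play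
  continues on \<open>C - {x}\<close> with the strategy that remembers \<open>fst x\<close>.\<close>

lemma winning_orders_Suc:
  assumes "finite C" "C \<noteq> {}"
  shows "winning_orders C (Suc m) \<sigma> =
    (\<Sum>x\<in>{x\<in>C. fst x \<noteq> \<sigma> []}. winning_orders (C - {x}) m (\<lambda>h. \<sigma> (fst x # h)))"
proof -
  let ?A = "\<lambda>x. (#) x ` {cs \<in> permutations_of_set (C - {x}).
    survives m (\<lambda>h. \<sigma> (fst x # h)) (map fst cs)}"
  have "{cs \<in> permutations_of_set C. survives (Suc m) \<sigma> (map fst cs)} =
      (\<Union>x\<in>{x\<in>C. fst x \<noteq> \<sigma> []}. ?A x)"
    using assms by (auto simp: permutations_of_set_nonempty survives_Cons)
  also have "card \<dots> = (\<Sum>x\<in>{x\<in>C. fst x \<noteq> \<sigma> []}. card (?A x))"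
    using assms by (intro card_UN_disjoint) auto
  finally show ?thesis
    by (simp add: winning_orders_def card_image)
qed

lemma sum_best_remove:
  assumes "finite C" "fst ` C \<subseteq> {1..v}"
  shows "(\<Sum>x\<in>{x\<in>C. fst x \<noteq> i}. best v m (value_count (C - {x})) * n) =
    (\<Sum>k\<in>{1..v} - {i}. weight v m (value_count C) k) * n"
proof -
  have "(\<Sum>x\<in>{x\<in>C. fst x \<noteq> i}. best v m (value_count (C - {x})) * n) =
     (\<Sum>x\<in>{x\<in>C. fst x \<noteq> i}.
        best v m ((value_count C)(fst x := value_count C (fst x) - 1)) * n)"
    using assms(1) by (intro sum.cong) (simp_all add: value_count_remove)
  also have "\<dots> = (\<Sum>k\<in>{1..v} - {i}. weight v m (value_count C) k) * n"
    using sum_by_value[OF assms, where i=i and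
        g="\<lambda>k. best v m ((value_count C)(k := value_count C k - 1)) * n"]
    by (simp add: weight_def sum_distrib_right mult.assoc)
  finally show ?thesis .
qed

text \<open>Two estimates are chained: induction for each continuation, then
  \<open>best_ge_bid\<close> for the first bid. The factorial counts the orders of the cards never
  turned; it is the same for all continuations because
  \<open>card (C - {x}) - m = card C - Suc m\<close>.\<close>

lemma winning_orders_le:
  assumes "finite C" "fst ` C \<subseteq> {1..v}" "strategy v \<sigma>" "m \<le> card C"
  shows "winning_orders C m \<sigma> \<le> best v m (value_count C) * fact (card C - m)"
  using assms
proof (induction m arbitrary: C \<sigma>)
  case 0
  then show ?case by (simp add: winning_orders_def survives_def)
next
  case (Suc m)
  then have "C \<noteq> {}" by auto
  have "winning_orders C (Suc m) \<sigma> =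
      (\<Sum>x\<in>{x\<in>C. fst x \<noteq> \<sigma> []}. winning_orders (C - {x}) m (\<lambda>h. \<sigma> (fst x # h)))"
    using Suc.prems(1) \<open>C \<noteq> {}\<close> by (rule winning_orders_Suc)
  also have "\<dots> \<le> (\<Sum>x\<in>{x\<in>C. fst x \<noteq> \<sigma> []}.
      best v m (value_count (C - {x})) * fact (card C - Suc m))"
  proof (rule sum_mono)
    fix x assume "x \<in> {x\<in>C. fst x \<noteq> \<sigma> []}"
    then have x: "x \<in> C" by simp
    then have "fst ` (C - {x}) \<subseteq> {1..v}" "m \<le> card (C - {x})"
      using Suc.prems by auto
    with x show "winning_orders (C - {x}) m (\<lambda>h. \<sigma> (fst x # h)) \<le>
        best v m (value_count (C - {x})) * fact (card C - Suc m)"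
      using Suc.prems Suc.IH[of "C - {x}" "\<lambda>h. \<sigma> (fst x # h)"] by (auto simp: strategy_def)
  qed
  also have "\<dots> = (\<Sum>k\<in>{1..v} - {\<sigma> []}. weight v m (value_count C) k) * fact (card C - Suc m)"
    using Suc.prems by (intro sum_best_remove)
  also have "\<dots> \<le> best v (Suc m) (value_count C) * fact (card C - Suc m)"
    using Suc.prems(3) by (intro mult_right_mono best_ge_bid) (auto simp: strategy_def)
  finally show ?case .
qed

section \<open>Rarest bids and equality in the bound\<close>

definition rarest :: "nat \<Rightarrow> nat list \<Rightarrow> nat \<Rightarrow> bool" where
  "rarest v xs i \<longleftrightarrow> (\<forall>j\<in>{1..v}. count_list xs i \<le> count_list xs j)"

lemma count_list_permutation:
  assumes "cs \<in> permutations_of_set C"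
  shows "count_list (map fst cs) i = value_count C i"
proof -
  have "count_list (map fst cs) i = length (filter (\<lambda>c. fst c = i) cs)"
    by (induction cs) auto
  also have "\<dots> = card (set (filter (\<lambda>c. fst c = i) cs))"
    using assms by (metis distinct_card distinct_filter permutations_of_setD(2))
  also have "set (filter (\<lambda>c. fst c = i) cs) = {c\<in>C. fst c = i}"
    using assms by (auto simp: permutations_of_set_def)
  finally show ?thesis by (simp add: value_count_def)
qed

text \<open>Both estimates behind \<open>winning_orders_le\<close> become equalities: the
  continuations by induction, the first bid by \<open>bid_eq_best_iff\<close>.\<close>

lemma winning_orders_greedy:
  assumes "3 \<le> v" "finite C" "fst ` C \<subseteq> {1..v}" "strategy v \<sigma>" "m \<le> card C"
    and "\<And>cs k. cs \<in> permutations_of_set C \<Longrightarrow> k < m \<Longrightarrow>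
           rarest v (map fst (drop k cs)) (\<sigma> (map fst (take k cs)))"
  shows "winning_orders C m \<sigma> = best v m (value_count C) * fact (card C - m)"
  using assms
proof (induction m arbitrary: C \<sigma>)
  case 0
  then show ?case by (simp add: winning_orders_def survives_def)
next
  case (Suc m)
  then have "C \<noteq> {}" by auto
  have strat: "\<sigma> [] \<in> {1..v}" using Suc.prems(4) by (simp add: strategy_def)
  have m: "m < (\<Sum>k=1..v. value_count C k)"
    using sum_value_count[OF Suc.prems(2,3)] Suc.prems(5) by simp
  \<comment> \<open>Any order of \<open>C\<close> serves to read off the condition on the first
    bid.\<close>
  obtain cs where cs: "cs \<in> permutations_of_set C"
    using permutations_of_set_empty_iff Suc.prems(2) by blast
  have "rarest v (map fst cs) (\<sigma> [])"
    using Suc.prems(6)[OF cs, of 0] by simp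
  then have min: "\<forall>j\<in>{1..v}. value_count C (\<sigma> []) \<le> value_count C j"
    by (simp add: rarest_def count_list_permutation[OF cs])
  have "winning_orders C (Suc m) \<sigma> =
      (\<Sum>x\<in>{x\<in>C. fst x \<noteq> \<sigma> []}. winning_orders (C - {x}) m (\<lambda>h. \<sigma> (fst x # h)))"
    using Suc.prems(2) \<open>C \<noteq> {}\<close> by (rule winning_orders_Suc)
  also have "\<dots> = (\<Sum>x\<in>{x\<in>C. fst x \<noteq> \<sigma> []}.
      best v m (value_count (C - {x})) * fact (card C - Suc m))"
  proof (intro sum.cong refl)
    fix x assume "x \<in> {x\<in>C. fst x \<noteq> \<sigma> []}"
    then have x: "x \<in> C" by simp
    have "rarest v (map fst (drop k ds)) (\<sigma> (fst x # map fst (take k ds)))"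
      if "ds \<in> permutations_of_set (C - {x})" "k < m" for ds k
      using Suc.prems(6)[of "x # ds" "Suc k"] that x by (simp add: Cons_in_permutations)
    moreover have "fst ` (C - {x}) \<subseteq> {1..v}" "m \<le> card (C - {x})"
      using Suc.prems x by auto
    ultimately show "winning_orders (C - {x}) m (\<lambda>h. \<sigma> (fst x # h)) =
        best v m (value_count (C - {x})) * fact (card C - Suc m)"
      using Suc.prems x Suc.IH[of "C - {x}" "\<lambda>h. \<sigma> (fst x # h)"] by (auto simp: strategy_def)
  qed
  also have "\<dots> = (\<Sum>k\<in>{1..v} - {\<sigma> []}. weight v m (value_count C) k) * fact (card C - Suc m)"
    using Suc.prems by (intro sum_best_remove)
  also have "\<dots> = best v (Suc m) (value_count C) * fact (card C - Suc m)"
    using bid_eq_best_iff[OF Suc.prems(1) m strat] min by simp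
  finally show ?case .
qed

text \<open>Equality overall forces equality in both estimates: the first bid is best, and every
  continuation attains its own bound. Only first cards that miss the bid have a continuation in the
  sum, hence the hypothesis on \<open>survives\<close>.\<close>

lemma greedy_if_winning_orders_eq:
  assumes "3 \<le> v" "finite C" "fst ` C \<subseteq> {1..v}" "strategy v \<sigma>" "m \<le> card C"
    and "winning_orders C m \<sigma> = best v m (value_count C) * fact (card C - m)"
    and "cs \<in> permutations_of_set C" "k < m" "survives k \<sigma> (map fst cs)"
  shows "rarest v (map fst (drop k cs)) (\<sigma> (map fst (take k cs)))"
  using assms
proof (induction m arbitrary: C \<sigma> cs k)
  case (Suc m)
  then have "C \<noteq> {}" by auto
  have strat: "\<sigma> [] \<in> {1..v}" using Suc.prems(4) by (simp add: strategy_def)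
  have m: "m < (\<Sum>k=1..v. value_count C k)"
    using sum_value_count[OF Suc.prems(2,3)] Suc.prems(5) by simp
  let ?C = "{x\<in>C. fst x \<noteq> \<sigma> []}"
  let ?w = "\<lambda>x. winning_orders (C - {x}) m (\<lambda>h. \<sigma> (fst x # h))"
  let ?b = "\<lambda>x. best v m (value_count (C - {x})) * fact (card C - Suc m)"
  have w_le_b: "?w x \<le> ?b x" if "x \<in> ?C" for x
  proof -
    have "fst ` (C - {x}) \<subseteq> {1..v}" "m \<le> card (C - {x})"
      using that Suc.prems by auto
    then show ?thesis
      using that Suc.prems winning_orders_le[of "C - {x}" v "\<lambda>h. \<sigma> (fst x # h)" m]
      by (auto simp: strategy_def)
  qed
  then have "sum ?w ?C \<le> sum ?b ?C" by (rule sum_mono)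
  moreover have b: "sum ?b ?C =
      (\<Sum>k\<in>{1..v} - {\<sigma> []}. weight v m (value_count C) k) * fact (card C - Suc m)"
    using Suc.prems by (intro sum_best_remove)
  moreover have "\<dots> \<le> best v (Suc m) (value_count C) * fact (card C - Suc m)"
    using strat by (intro mult_right_mono best_ge_bid) auto
  moreover have "sum ?w ?C = best v (Suc m) (value_count C) * fact (card C - Suc m)"
    using Suc.prems(6) winning_orders_Suc[OF Suc.prems(2) \<open>C \<noteq> {}\<close>, of m \<sigma>] by simp
  ultimately have eq: "sum ?w ?C = sum ?b ?C"
    and "(\<Sum>k\<in>{1..v} - {\<sigma> []}. weight v m (value_count C) k) * fact (card C - Suc m) =
      best v (Suc m) (value_count C) * fact (card C - Suc m)"
    by linarith+
  then have "(\<Sum>k\<in>{1..v} - {\<sigma> []}. weight v m (value_count C) k) = best v (Suc m) (value_count C)"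
    by simp
  then have min: "\<forall>j\<in>{1..v}. value_count C (\<sigma> []) \<le> value_count C j"
    using bid_eq_best_iff[OF Suc.prems(1) m strat] by blast
  show ?case
  proof (cases k)
    case 0
    then show ?thesis
      using min by (simp add: rarest_def count_list_permutation[OF Suc.prems(7)])
  next
    case (Suc l)
    obtain x ds where cs: "cs = x # ds"
      using Suc.prems(7) \<open>C \<noteq> {}\<close> by (cases cs) (auto simp: permutations_of_set_def)
    have x: "x \<in> ?C" and ds: "ds \<in> permutations_of_set (C - {x})"
      and surv: "survives l (\<lambda>h. \<sigma> (fst x # h)) (map fst ds)"
      using Suc.prems(7,9) by (auto simp: cs Suc Cons_in_permutations survives_Cons)
    \<comment> \<open>No other continuation can make up for a deficient one, since each is at most
      its bound.\<close>
    have "?w x = ?b x"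
    proof (rule ccontr)
      assume "?w x \<noteq> ?b x"
      then have "?w x < ?b x" using w_le_b[OF x] by (rule le_neq_implies_less[rotated])
      then have "sum ?w ?C < sum ?b ?C"
        using w_le_b x Suc.prems(2) by (intro sum_strict_mono_ex1) (simp, blast+)
      then show False using eq by simp
    qed
    then have "rarest v (map fst (drop l ds)) (\<sigma> (fst x # map fst (take l ds)))"
      using Suc.prems x ds surv Suc
      by (intro Suc.IH[of "C - {x}" "\<lambda>h. \<sigma> (fst x # h)"]) (auto simp: strategy_def)
    then show ?thesis by (simp add: cs Suc)
  qed
qed simp

section \<open>From counts of orders to winning probabilities\<close>

lemma fst_cards: "fst ` cards v s \<subseteq> {1..v}"
  by (auto simp: cards_def)

lemma card_cards: "card (cards v s) = (\<Sum>i=1..v. s i)"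
  by (simp add: cards_def)

lemma win_prob_eq:
  "win_prob v s m \<sigma> = winning_orders (cards v s) m \<sigma> / fact (card (cards v s))"
proof -
  have "permutations_of_set (cards v s) \<noteq> {}"
    by (simp add: finite_cards)
  moreover have "permutations_of_set (cards v s) \<inter> map fst -` {xs. survives m \<sigma> xs} =
      {cs \<in> permutations_of_set (cards v s). survives m \<sigma> (map fst cs)}"
    by auto
  ultimately show ?thesis
    by (simp add: win_prob_def shuffled_deck_def measure_pmf_of_set winning_orders_def finite_cards)
qed

lemma win_prob_le_iff:
  "win_prob v s m \<tau> \<le> win_prob v s m \<sigma> \<longleftrightarrow>
    winning_orders (cards v s) m \<tau> \<le> winning_orders (cards v s) m \<sigma>"
  by (simp add: win_prob_eq divide_le_cancel)

lemma greedy_iff_rarest: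
  "greedy v s m \<sigma> \<longleftrightarrow> strategy v \<sigma> \<and>
    (\<forall>xs\<in>set_pmf (shuffled_deck v s). \<forall>k<m. rarest v (drop k xs) (\<sigma> (take k xs)))"
  by (simp add: greedy_def rarest_def)

text \<open>The cards seen determine the counts that remain, so a strategy can decide from its
  history whether a bid is rarest.\<close>

lemma rarest_drop_iff:
  assumes "xs \<in> set_pmf (shuffled_deck v s)" "i \<in> {1..v}"
  shows "rarest v (drop k xs) i \<longleftrightarrow>
    (\<forall>j\<in>{1..v}. s i - count_list (take k xs) i \<le> s j - count_list (take k xs) j)"
proof -
  have "count_list (drop k xs) j = s j - count_list (take k xs) j" if "j \<in> {1..v}" for j
    using count_list_append[of "take k xs" "drop k xs" j] count_list_shuffled_deck[OF assms(1) that]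
    by simp
  then show ?thesis using assms(2) by (simp add: rarest_def)
qed

theorem theorem1p2:
  fixes v m :: nat and s :: "nat \<Rightarrow> nat"
  assumes "v \<ge> 3" and "m \<le> (\<Sum>i=1..v. s i)"
  shows "(\<forall>\<sigma>. greedy v s m \<sigma> \<longrightarrow> optimal v s m \<sigma>) \<and>
         (\<forall>\<sigma>. optimal v s m \<sigma> \<longrightarrow> (\<exists>\<tau>. greedy v s m \<tau> \<and> same_play v s m \<sigma> \<tau>))"
proof (intro conjI allI impI)
  let ?C = "cards v s"
  let ?max = "best v m (value_count ?C) * fact (card ?C - m)"
  have m: "m \<le> card ?C" using assms(2) by (simp add: card_cards)
  have upper: "winning_orders ?C m \<tau> \<le> ?max" if "strategy v \<tau>" for \<tau>
    using that m by (intro winning_orders_le finite_cards fst_cards)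
  have attained: "winning_orders ?C m \<tau> = ?max" if "greedy v s m \<tau>" for \<tau>
    using that m assms(1)
    by (intro winning_orders_greedy finite_cards fst_cards)
      (auto simp: greedy_iff_rarest set_shuffled_deck drop_map take_map)
  {
    fix \<sigma> assume \<sigma>: "greedy v s m \<sigma>"
    then show "optimal v s m \<sigma>"
      using upper attained[OF \<sigma>] by (simp add: optimal_def win_prob_le_iff greedy_iff_rarest)
  }
  fix \<sigma> assume "optimal v s m \<sigma>"
  then have strat: "strategy v \<sigma>"
    and opt: "\<And>\<tau>. strategy v \<tau> \<Longrightarrow> winning_orders ?C m \<tau> \<le> winning_orders ?C m \<sigma>"
    by (auto simp: optimal_def win_prob_le_iff)
  \<comment> \<open>A greedy strategy attains the upper bound, hence so does the optimal
    \<open>\<sigma>\<close>.\<close>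
  obtain \<gamma> where \<gamma>: "greedy v s m \<gamma>"
    using greedy_exists[of v s m] assms(1) by auto
  then have "winning_orders ?C m \<sigma> = ?max"
    using opt[of \<gamma>] upper[OF strat] attained[OF \<gamma>] by (simp add: greedy_iff_rarest)
  then have rarest: "rarest v (drop k xs) (\<sigma> (take k xs))"
    if "xs \<in> set_pmf (shuffled_deck v s)" "k < m" "survives k \<sigma> xs" for xs k
    using that greedy_if_winning_orders_eq[OF assms(1) finite_cards fst_cards strat m]
    by (auto simp: set_shuffled_deck drop_map take_map)
  \<comment> \<open>Optimality does not constrain \<open>\<sigma>\<close> after a loss, so its bids are replaced there by those of \<open>\<gamma>\<close>.\<close>
  define \<tau> where "\<tau> h = (if \<forall>j\<in>{1..v}. s (\<sigma> h) - count_list h (\<sigma> h) \<le> s j - count_list h j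
    then \<sigma> h else \<gamma> h)" for h
  have \<tau>: "\<tau> (take k xs) =
      (if rarest v (drop k xs) (\<sigma> (take k xs)) then \<sigma> (take k xs) else \<gamma> (take k xs))"
    if "xs \<in> set_pmf (shuffled_deck v s)" for xs k
    using rarest_drop_iff[OF that, of "\<sigma> (take k xs)" k] strat by (simp add: \<tau>_def strategy_def)
  have "strategy v \<tau>"
    using strat \<gamma> by (simp add: \<tau>_def strategy_def greedy_iff_rarest)
  then have "greedy v s m \<tau>"
    using \<gamma> \<tau> by (auto simp: greedy_iff_rarest)
  \<comment> \<open>As long as \<open>\<sigma>\<close> has not lost, its bids are rarest, so
    \<open>\<tau>\<close> copies them.\<close>
  moreover have "same_play v s m \<sigma> \<tau>"
    using rarest \<tau> by (auto simp: same_play_def)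
  ultimately show "\<exists>\<tau>. greedy v s m \<tau> \<and> same_play v s m \<sigma> \<tau>" by blast
qed

end
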